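(* Let $n \ge 1$ and let $X_1, \dots, X_n$ be independent real-valued random variables supported on $[0,1]$, with $\mu_i = \mathbb{E}[X_i]$ for each $i$. Define $Y = \sum_{i=1}^n (X_i - \mu_i)$. Let $m \ge 1$ be an integer and let $Y^1, \dots, Y^m$ be independent copies of $Y$. Then $$\mathbb{E}\left[\max\left\{0, Y^1, \dots, Y^m\right\}\right] \leq 4\sqrt{n \cdot \ln(m+1)}.$$
   Context: "Supported on $[0,1]$" means the random variable takes values in $[0,1]$ (almost surely). "Independent copies of $Y$" means mutually independent random variables, each with the same distribution as $Y$; superscripts are indices, not powers. *)

theory Defs
  imports "HOL-Probability.Probability"
begin

end

theory Submission
  imports Defs
begin

text \<open>
  Hoeffding's lemma bounds the moment generating function of \<open>Y\<close> at \<open>l > 0\<close> by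
  \<open>K = exp (l\<^sup>2 n / 8)\<close>. The exponential of \<open>l\<close> times the maximum is at most
  \<open>1 + (\<Sum>j. exp (l Z\<^sub>j))\<close>, so its expectation is at most \<open>(m + 1) K\<close>, and by Jensen's inequality
  the maximum has expectation at most \<open>ln (m + 1) / l + l n / 8\<close>. Optimising over \<open>l\<close> gives
  \<open>sqrt (n ln (m + 1) / 2)\<close>, which is better than claimed.
\<close>

text \<open>The exponential turns the sum into a product, independence factors its integral, and
  Hoeffding's lemma bounds each factor. With nonnegative integrals the factorisation raises no
  integrability questions.\<close>

lemma (in indep_interval_bounded_random_variables) nn_integral_exp_centered_sum_le:
  assumes l: "l > 0"
  shows "(\<integral>\<^sup>+x. ennreal (exp (l * (\<Sum>i\<in>I. X i x - expectation (X i)))) \<partial>M)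
           \<le> ennreal (exp (l\<^sup>2 * (\<Sum>i\<in>I. (b i - a i)\<^sup>2) / 8))"
proof -
  have "(\<integral>\<^sup>+x. ennreal (exp (l * (\<Sum>i\<in>I. X i x - expectation (X i)))) \<partial>M) =
        (\<integral>\<^sup>+x. (\<Prod>i\<in>I. ennreal (exp (l * (X i x - expectation (X i))))) \<partial>M)"
    by (intro nn_integral_cong) (simp add: sum_distrib_left exp_sum fin prod_ennreal)
  also have "\<dots> = (\<Prod>i\<in>I. \<integral>\<^sup>+x. ennreal (exp (l * (X i x - expectation (X i)))) \<partial>M)"
    by (intro indep_vars_nn_integral fin indep_vars_compose2[OF indep]) auto
  also have "\<dots> \<le> (\<Prod>i\<in>I. ennreal (exp (l\<^sup>2 * (b i - a i)\<^sup>2 / 8)))"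
  proof (intro prod_mono_ennreal)
    fix i assume i: "i \<in> I"
    interpret interval_bounded_random_variable M "X i" "a i" "b i"
      using i ..
    show "(\<integral>\<^sup>+x. ennreal (exp (l * (X i x - expectation (X i)))) \<partial>M)
            \<le> ennreal (exp (l\<^sup>2 * (b i - a i)\<^sup>2 / 8))"
      by (rule Hoeffdings_lemma_nn_integral) fact
  qed
  also have "\<dots> = ennreal (exp (l\<^sup>2 * (\<Sum>i\<in>I. (b i - a i)\<^sup>2) / 8))"
    by (simp add: prod_ennreal exp_sum fin sum_distrib_left sum_divide_distrib)
  finally show ?thesis .
qed

text \<open>The maximum is attained, so its scaled exponential is one of the nonnegative terms
  \<open>1\<close> and \<open>exp (l * Z j x)\<close> and hence at most their sum. Concavity of
  \<open>ln\<close> carries the bound on the mean of this sum back to the mean of the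
  maximum.\<close>

lemma (in prob_space) expectation_Max_le_of_mgf_le:
  fixes Z :: "'i \<Rightarrow> 'a \<Rightarrow> real"
  assumes J: "finite J" and l: "l > 0" and K: "K \<ge> 1"
    and meas [measurable]: "\<And>j. j \<in> J \<Longrightarrow> random_variable borel (Z j)"
    and mgf: "\<And>j. j \<in> J \<Longrightarrow> (\<integral>\<^sup>+x. ennreal (exp (l * Z j x)) \<partial>M) \<le> ennreal K"
  shows "expectation (\<lambda>x. Max (insert 0 ((\<lambda>j. Z j x) ` J))) \<le> (ln (card J + 1) + ln K) / l"
proof -
  \<comment> \<open>\<open>c\<close> bounds the mean of
    \<open>1 + (\<Sum>j\<in>J. exp (l * Z j x))\<close>, with \<open>K \<ge> 1\<close> absorbing the
    term \<open>1\<close> that comes from the element \<open>0\<close>. Linearising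
    \<open>ln\<close> at this point leaves just \<open>ln c\<close> after integration.\<close>
  define c where "c = (card J + 1) * K"
  define g where "g x = ((1 + (\<Sum>j\<in>J. exp (l * Z j x))) / c - 1 + ln c) / l" for x
  have c: "c > 0"
    using K by (simp add: c_def)
  have int: "integrable M (\<lambda>x. exp (l * Z j x))" if "j \<in> J" for j
    using that mgf[OF that] by (intro integrableI_nonneg) (auto simp: top_unique less_top[symmetric])
  have exp_le: "expectation (\<lambda>x. exp (l * Z j x)) \<le> K" if "j \<in> J" for j
    using mgf[OF that] K by (simp add: nn_integral_eq_integral[OF int[OF that]])
  have int_g: "integrable M g"
    unfolding g_def using int by auto
  have Max_le: "Max (insert 0 ((\<lambda>j. Z j x) ` J)) \<le> g x" for x
  proof -
    let ?S = "insert 0 ((\<lambda>j. Z j x) ` J)"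
    have "Max ?S \<in> ?S"
      using J by (intro Max_in) auto
    then have "exp (l * Max ?S) \<le> 1 + (\<Sum>j\<in>J. exp (l * Z j x))"
    proof
      assume "Max ?S = 0"
      then show ?thesis by (simp add: sum_nonneg)
    next
      assume "Max ?S \<in> (\<lambda>j. Z j x) ` J"
      then obtain j where j: "j \<in> J" "Max ?S = Z j x" by blast
      have "exp (l * Z j x) \<le> (\<Sum>j\<in>J. exp (l * Z j x))"
        by (rule member_le_sum) (use j J in auto)
      then show ?thesis unfolding j(2) by simp
    qed
    then have "exp (l * Max ?S) / c \<le> (1 + (\<Sum>j\<in>J. exp (l * Z j x))) / c"
      using c by (intro divide_right_mono) auto
    \<comment> \<open>The tangent line of \<open>ln\<close> at \<open>c\<close> replaces Jensen's inequality.\<close>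
    moreover have "1 + (l * Max ?S - ln c) \<le> exp (l * Max ?S - ln c)"
      by (rule exp_ge_add_one_self)
    then have "1 + (l * Max ?S - ln c) \<le> exp (l * Max ?S) / c"
      using c by (simp add: exp_diff)
    ultimately have "l * Max ?S \<le> (1 + (\<Sum>j\<in>J. exp (l * Z j x))) / c - 1 + ln c"
      by linarith
    then show ?thesis
      unfolding g_def using l by (simp add: pos_le_divide_eq mult.commute)
  qed
  have "expectation (\<lambda>x. Max (insert 0 ((\<lambda>j. Z j x) ` J))) \<le> expectation g"
  \<comment> \<open>The integral of a non-integrable function is \<open>0\<close> by default, so a
    nonnegative integrable upper bound \<open>g\<close> suffices.\<close>
  proof (rule integral_mono'[OF int_g Max_le])
    fix x
    have "0 \<le> Max (insert 0 ((\<lambda>j. Z j x) ` J))"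
      using J by (intro Max_ge) auto
    then show "0 \<le> g x"
      using Max_le[of x] by linarith
  qed
  also have "\<dots> = ((1 + (\<Sum>j\<in>J. expectation (\<lambda>x. exp (l * Z j x)))) / c - 1 + ln c) / l"
    unfolding g_def using int by (simp add: prob_space)
  also have "\<dots> \<le> ((1 + (\<Sum>j\<in>J. K)) / c - 1 + ln c) / l"
    using c l by (intro divide_right_mono add_mono diff_mono sum_mono exp_le) auto
  also have "\<dots> \<le> ln c / l"
    using c l K by (intro divide_right_mono) (auto simp: c_def field_simps)
  also have "ln c = ln (card J + 1) + ln K"
    unfolding c_def using K by (intro ln_mult_pos) auto
  finally show ?thesis by simp
qed

theorem proposition2p5:
  fixes M :: "'a measure" and N :: "'b measure"
    and X :: "nat \<Rightarrow> 'a \<Rightarrow> real" and \<mu> :: "nat \<Rightarrow> real"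
    and Y :: "'a \<Rightarrow> real" and Z :: "nat \<Rightarrow> 'b \<Rightarrow> real"
    and n m :: nat
  assumes "prob_space M" and "prob_space N"
    and "n \<ge> 1" and "m \<ge> 1"
    and X_indep: "prob_space.indep_vars M (\<lambda>_. borel) X {1..n}"
    and X_supp: "\<And>i. i \<in> {1..n} \<Longrightarrow> AE \<omega> in M. X i \<omega> \<in> {0..1}"
    and mu: "\<And>i. i \<in> {1..n} \<Longrightarrow> \<mu> i = (\<integral>\<omega>. X i \<omega> \<partial>M)"
    and Y: "\<And>\<omega>. Y \<omega> = (\<Sum>i=1..n. X i \<omega> - \<mu> i)"
    and Z_indep: "prob_space.indep_vars N (\<lambda>_. borel) Z {1..m}"
    and Z_copy: "\<And>j. j \<in> {1..m} \<Longrightarrow> distr N borel (Z j) = distr M borel Y"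
  shows "(\<integral>\<omega>. Max (insert 0 ((\<lambda>j. Z j \<omega>) ` {1..m})) \<partial>N)
           \<le> 4 * sqrt (real n * ln (real m + 1))"
proof -
  interpret M: prob_space M by fact
  interpret N: prob_space N by fact
  interpret X: indep_interval_bounded_random_variables M "{1..n}" X "\<lambda>_. 0" "\<lambda>_. 1"
    by unfold_locales (use X_indep X_supp in auto)
  have Y_eq: "Y = (\<lambda>\<omega>. \<Sum>i=1..n. X i \<omega> - M.expectation (X i))"
    by (rule ext) (simp add: Y mu)
  have Y_meas [measurable]: "Y \<in> borel_measurable M"
    unfolding Y_eq by measurable
  have Z_meas [measurable]: "Z j \<in> borel_measurable N" if "j \<in> {1..m}" for j
    using Z_indep that unfolding N.indep_vars_def by blast
  define L where "L = ln (real m + 1)"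
  \<comment> \<open>This minimises \<open>L / l + l * n / 8\<close>: the two terms become equal,
    that is, \<open>ln K = L\<close>.\<close>
  define l where "l = sqrt (8 * L / n)"
  define K where "K = exp (l\<^sup>2 * n / 8)"
  have L: "L > 0"
    using \<open>m \<ge> 1\<close> by (simp add: L_def)
  have l: "l > 0" and l_sq: "l\<^sup>2 = 8 * L / n"
    using L \<open>n \<ge> 1\<close> by (auto simp: l_def)
  have mgf: "(\<integral>\<^sup>+\<omega>. ennreal (exp (l * Z j \<omega>)) \<partial>N) \<le> ennreal K" if j: "j \<in> {1..m}" for j
  proof -
    \<comment> \<open>\<open>Z j\<close> and \<open>Y\<close> live on different spaces, so the bound
      passes through their common distribution on the reals.\<close>
    have "(\<integral>\<^sup>+\<omega>. ennreal (exp (l * Z j \<omega>)) \<partial>N) = (\<integral>\<^sup>+y. ennreal (exp (l * y)) \<partial>distr N borel (Z j))"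
      using j by (subst nn_integral_distr) auto
    also have "\<dots> = (\<integral>\<^sup>+\<omega>. ennreal (exp (l * Y \<omega>)) \<partial>M)"
      unfolding Z_copy[OF j] by (subst nn_integral_distr) auto
    also have "\<dots> \<le> ennreal K"
      using X.nn_integral_exp_centered_sum_le[OF l] by (simp add: Y_eq K_def)
    finally show ?thesis .
  qed
  have "(\<integral>\<omega>. Max (insert 0 ((\<lambda>j. Z j \<omega>) ` {1..m})) \<partial>N) \<le> (ln (card {1..m} + 1) + ln K) / l"
    by (rule N.expectation_Max_le_of_mgf_le) (use l mgf in \<open>auto simp: K_def\<close>)
  also have "\<dots> = 2 * L / l"
    using \<open>n \<ge> 1\<close> by (simp add: K_def l_sq L_def add.commute)
  also have "\<dots> \<le> 4 * sqrt (n * L)"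
  proof -
    \<comment> \<open>Multiplied by \<open>l\<close>, the goal reads
      \<open>2 * L \<le> 4 * sqrt 8 * L\<close>, for which the crude bound
      \<open>1 \<le> sqrt 8\<close> is enough.\<close>
    have "l * sqrt (n * L) = sqrt 8 * L"
      using L \<open>n \<ge> 1\<close> by (simp add: l_def flip: real_sqrt_mult) (simp add: real_sqrt_mult)
    moreover have "1 * L \<le> sqrt 8 * L"
      using L by (intro mult_right_mono) auto
    then have "2 * L \<le> 4 * (sqrt 8 * L)"
      using L by linarith
    ultimately show ?thesis
      using l by (simp add: pos_divide_le_eq mult_ac)
  qed
  finally show ?thesis
    by (simp add: L_def)
qed

end
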